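(* Let $V$ be a set of agents, $A$ a set of alternatives, $a,b$ two distinct elements of $A$, and let $\mathcal P\subseteq \mathcal W(A)^V$ be a quasi-cartesian restricted domain. Let $\chi:\mathcal P\to\mathcal D$ be the function $$\chi(P)=\big(D(a,P),\,I(P),\,(P_v)_{v\in I(P)}\big).$$ Then the map $C\mapsto \phi_{(\chi,C)}$ is a bijection from the set of all super order closed (SOC) subsets of the poset $\big(\chi(\mathcal P),\le_{\mathcal D}\big)$ onto the set of all weakly group strategy-proof social choice functions from $\mathcal P$ to $\{a,b\}$, where $\phi_{(\chi,C)}:\mathcal P\to\{a,b\}$ is defined by $\phi_{(\chi,C)}(P)=a\iff \chi(P)\in C$.
   Context: $V$ and $A$ are arbitrary sets (possibly infinite). $\mathcal W(A)$ is the set of all complete, transitive binary relations (preferences) on $A$. For $W\in\mathcal W(A)$: $x\succsim_W y$ means $(x,y)\in W$; $x\succ_W y$ means $(x,y)\in W$ and $(y,x)\notin W$; $x\sim_W y$ means both $(x,y),(y,x)\in W$. A profile is a function $P=(P_v)_{v\in V}$ from $V$ to $\mathcal W(A)$; a partial profile is a function from a subset $T$ of $V$ (possibly empty) to $\mathcal W(A)$. A set $\mathcal P\subseteq\mathcal W(A)^V$ of feasible profiles is a quasi-cartesian restricted domain if for all $P,Q\in\mathcal P$ and $T\subseteq V$ the profile $[P_T,Q_{T^c}]$ (equal to $P$ on $T$ and to $Q$ on $T^c=V\setminus T$) belongs to $\mathcal P$. A social choice function (scf) is a function $\phi:\mathcal P\to A$. It is weakly group strategy-proof if there are no nonempty $D\subseteq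 V$ and $P,Q\in\mathcal P$ such that $P_v=Q_v$ for all $v\in V\setminus D$ and $\phi(Q)\succ_{P_v}\phi(P)$ for all $v\in D$. $D(a,P)=\{v\in V: a\succ_{P_v} b\}$ and $I(P)=\{v\in V: a\sim_{P_v} b\}$. $\mathcal D$ is the set of triples $(S,T,\pi)$ with $S,T$ disjoint subsets of $V$ and $\pi=(\pi_v)_{v\in T}$ a partial profile with domain $T$. It is partially ordered by: $(S,T,\pi)\le_{\mathcal D}(S',T',\pi')$ iff $S\subseteq S'$, $S\cup T\subseteq S'\cup T'$, and $\pi_v=\pi'_v$ for all $v\in T\cap T'$. $\chi(\mathcal P)$ is the image of $\chi$, with the restricted order. A subset $C$ of a poset $(L,\ge)$ is super order closed (SOC) if $x\in L$, $f\in C$, $x\ge f$ imply $x\in C$ (the empty set is SOC). *)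

theory Defs
  imports Main "HOL-Library.FuncSet"
begin

text \<open>Completeness is required for all pairs, the diagonal included, so preferences are reflexive
  on \<open>A\<close> (unlike \<^const>\<open>total_on\<close>).\<close>

definition preferences :: "'a set \<Rightarrow> 'a rel set" where
  "preferences A =
    {W. W \<subseteq> A \<times> A \<and> (\<forall>x\<in>A. \<forall>y\<in>A. (x, y) \<in> W \<or> (y, x) \<in> W) \<and> trans W}"

definition strictly_prefers :: "'a rel \<Rightarrow> 'a \<Rightarrow> 'a \<Rightarrow> bool" where
  "strictly_prefers W x y \<longleftrightarrow> (x, y) \<in> W \<and> (y, x) \<notin> W"

definition indifferent :: "'a rel \<Rightarrow> 'a \<Rightarrow> 'a \<Rightarrow> bool" where
  "indifferent W x y \<longleftrightarrow> (x, y) \<in> W \<and> (y, x) \<in> W"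

text \<open>Functions on a set are represented throughout as extensional functions (\<^const>\<open>PiE\<close>), so
  that they are determined by their values on their domain. A partial profile with domain \<open>T\<close>
  is an element of \<open>profiles T A\<close>.\<close>

definition profiles :: "'v set \<Rightarrow> 'a set \<Rightarrow> ('v \<Rightarrow> 'a rel) set" where
  "profiles V A = V \<rightarrow>\<^sub>E preferences A"

text \<open>\<open>override_on Q P T\<close> is the profile equal to \<open>P\<close> on \<open>T\<close> and to \<open>Q\<close> elsewhere.\<close>

definition quasi_cartesian :: "'v set \<Rightarrow> 'a set \<Rightarrow> ('v \<Rightarrow> 'a rel) set \<Rightarrow> bool" where
  "quasi_cartesian V A \<P> \<longleftrightarrow>
    \<P> \<subseteq> profiles V A \<and> (\<forall>P\<in>\<P>. \<forall>Q\<in>\<P>. \<forall>T. T \<subseteq> V \<longrightarrow> override_on Q P T \<in> \<P>)"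

definition weakly_group_strategy_proof ::
  "'v set \<Rightarrow> ('v \<Rightarrow> 'a rel) set \<Rightarrow> (('v \<Rightarrow> 'a rel) \<Rightarrow> 'a) \<Rightarrow> bool" where
  "weakly_group_strategy_proof V \<P> \<phi> \<longleftrightarrow>
    \<not> (\<exists>D P Q. D \<noteq> {} \<and> D \<subseteq> V \<and> P \<in> \<P> \<and> Q \<in> \<P> \<and> (\<forall>v\<in>V - D. P v = Q v) \<and>
        (\<forall>v\<in>D. strictly_prefers (P v) (\<phi> Q) (\<phi> P)))"

definition supporters :: "'v set \<Rightarrow> 'a \<Rightarrow> 'a \<Rightarrow> ('v \<Rightarrow> 'a rel) \<Rightarrow> 'v set" where
  "supporters V a b P = {v \<in> V. strictly_prefers (P v) a b}"

definition indifferents :: "'v set \<Rightarrow> 'a \<Rightarrow> 'a \<Rightarrow> ('v \<Rightarrow> 'a rel) \<Rightarrow> 'v set" where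
  "indifferents V a b P = {v \<in> V. indifferent (P v) a b}"

definition triples ::
  "'v set \<Rightarrow> 'a set \<Rightarrow> ('v set \<times> 'v set \<times> ('v \<Rightarrow> 'a rel)) set" where
  "triples V A =
    {(S, T, \<pi>). S \<subseteq> V \<and> T \<subseteq> V \<and> S \<inter> T = {} \<and> \<pi> \<in> profiles T A}"

text \<open>A pair \<open>(x, y)\<close> in this relation means that \<open>x\<close> is below \<open>y\<close>.\<close>

definition triples_le ::
  "'v set \<Rightarrow> 'a set \<Rightarrow> ('v set \<times> 'v set \<times> ('v \<Rightarrow> 'a rel)) rel" where
  "triples_le V A =
    {((S, T, \<pi>), (S', T', \<pi>')). (S, T, \<pi>) \<in> triples V A \<and> (S', T', \<pi>') \<in> triples V A \<and>
      S \<subseteq> S' \<and> S \<union> T \<subseteq> S' \<union> T' \<and> (\<forall>v\<in>T \<inter> T'. \<pi> v = \<pi>' v)}"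

definition chi ::
  "'v set \<Rightarrow> 'a \<Rightarrow> 'a \<Rightarrow> ('v \<Rightarrow> 'a rel) \<Rightarrow> 'v set \<times> 'v set \<times> ('v \<Rightarrow> 'a rel)" where
  "chi V a b P = (supporters V a b P, indifferents V a b P, restrict P (indifferents V a b P))"

text \<open>The poset is given by its carrier \<open>L\<close> and its order relation \<open>r\<close>, where \<open>(f, x) \<in> r\<close> means
  that \<open>f\<close> is below \<open>x\<close>.\<close>

definition super_order_closed :: "'p set \<Rightarrow> 'p rel \<Rightarrow> 'p set \<Rightarrow> bool" where
  "super_order_closed L r C \<longleftrightarrow> C \<subseteq> L \<and> (\<forall>x\<in>L. \<forall>f\<in>C. (f, x) \<in> r \<longrightarrow> x \<in> C)"

definition phi ::
  "('v \<Rightarrow> 'a rel) set \<Rightarrow> 'a \<Rightarrow> 'a \<Rightarrow> (('v \<Rightarrow> 'a rel) \<Rightarrow> 'p) \<Rightarrow> 'p set \<Rightarrow> ('v \<Rightarrow> 'a rel) \<Rightarrow> 'a" where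
  "phi \<P> a b \<chi> C = (\<lambda>P\<in>\<P>. if \<chi> P \<in> C then a else b)"

lemma partial_order_on_triples_le: "partial_order_on (triples V A) (triples_le V A)"
proof -
  have "trans (triples_le V A)"
  proof (rule transI)
    fix x y z assume xy: "(x, y) \<in> triples_le V A" and yz: "(y, z) \<in> triples_le V A"
    obtain S T p where x: "x = (S, T, p)" by (cases x)
    obtain S' T' q where y: "y = (S', T', q)" by (cases y)
    obtain S'' T'' r where z: "z = (S'', T'', r)" by (cases z)
    have mem: "x \<in> triples V A" "z \<in> triples V A"
      using xy yz by (auto simp: triples_le_def)
    then have disj: "S'' \<inter> T'' = {}" by (simp add: z triples_def)
    have 1: "S \<subseteq> S'" "S \<union> T \<subseteq> S' \<union> T'" "\<forall>v\<in>T \<inter> T'. p v = q v"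
      using xy by (simp_all add: x y triples_le_def)
    have 2: "S' \<subseteq> S''" "S' \<union> T' \<subseteq> S'' \<union> T''" "\<forall>v\<in>T' \<inter> T''. q v = r v"
      using yz by (simp_all add: y z triples_le_def)
    have "p v = r v" if "v \<in> T \<inter> T''" for v
    proof -
      have "v \<in> T'" using that 1(2) 2(1) disj by blast
      then show ?thesis using that 1(3) 2(3) by simp
    qed
    moreover have "S \<subseteq> S''" "S \<union> T \<subseteq> S'' \<union> T''" using 1 2 by blast+
    ultimately show "(x, z) \<in> triples_le V A" using mem by (simp add: x z triples_le_def)
  qed
  moreover have "antisym (triples_le V A)"
  proof (rule antisymI)
    fix x y assume xy: "(x, y) \<in> triples_le V A" and yx: "(y, x) \<in> triples_le V A"
    obtain S T p where x: "x = (S, T, p)" by (cases x)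
    obtain S' T' q where y: "y = (S', T', q)" by (cases y)
    have S: "S = S'" using xy yx by (auto simp: x y triples_le_def)
    have "S \<inter> T = {}" "S' \<inter> T' = {}" "S \<union> T \<subseteq> S' \<union> T'" "S' \<union> T' \<subseteq> S \<union> T"
      using xy yx by (simp_all add: x y triples_le_def triples_def)
    with S have T: "T = T'" by blast
    have "p \<in> profiles T A" "q \<in> profiles T' A" "\<forall>v\<in>T \<inter> T'. p v = q v"
      using xy by (simp_all add: x y triples_le_def triples_def)
    then have "p \<in> T \<rightarrow>\<^sub>E preferences A" "q \<in> T \<rightarrow>\<^sub>E preferences A" "\<forall>v\<in>T. p v = q v"
      using T by (simp_all add: profiles_def)
    then have "p = q" by (metis PiE_ext)
    with S T show "x = y" by (simp add: x y)
  qed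
  moreover have "refl_on (triples V A) (triples_le V A)"
    by (auto simp: refl_on_def triples_le_def)
  ultimately show ?thesis
    by (auto simp: partial_order_on_def preorder_on_def triples_le_def)
qed

lemma chi_in_triples:
  assumes "P \<in> profiles V A"
  shows "chi V a b P \<in> triples V A"
  using assms
  by (auto simp: chi_def triples_def profiles_def supporters_def indifferents_def
      strictly_prefers_def indifferent_def)

end

theory Submission
  imports Defs
begin

text \<open>A joint deviation of agents who prefer \<open>a\<close> can only lower the triple, and one of agents who
  prefer \<open>b\<close> can only raise it, so neither is profitable when \<open>C\<close> is super order closed.
  Conversely, if the triple of \<open>P\<close> lies below that of \<open>Q\<close>, let \<open>R\<close> be
  equal to \<open>Q\<close> on the supporters of \<open>a\<close> at \<open>Q\<close> and to \<open>P\<close> elsewhere. Then \<open>R\<close> differs from \<open>P\<close> only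
  on agents who prefer \<open>a\<close> at \<open>R\<close>, and from \<open>Q\<close> only on agents who prefer \<open>b\<close> at \<open>R\<close>, so the choice
  of \<open>a\<close> passes from \<open>P\<close> to \<open>R\<close> and from \<open>R\<close> to \<open>Q\<close>.\<close>

lemma preferences_cases:
  assumes "W \<in> preferences A" "x \<in> A" "y \<in> A"
  obtains "strictly_prefers W x y" | "indifferent W x y" | "strictly_prefers W y x"
  using assms by (auto simp: preferences_def strictly_prefers_def indifferent_def)

lemma triples_le_chiI:
  assumes "P \<in> profiles V A" "Q \<in> profiles V A"
    and "supporters V a b P \<subseteq> supporters V a b Q"
    and "indifferents V a b P \<subseteq> supporters V a b Q \<union> indifferents V a b Q"
    and "\<forall>v\<in>indifferents V a b P \<inter> indifferents V a b Q. P v = Q v"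
  shows "(chi V a b P, chi V a b Q) \<in> triples_le V A"
  using assms chi_in_triples[of P V A a b] chi_in_triples[of Q V A a b]
  by (auto simp: triples_le_def chi_def)

text \<open>At \<open>P\<close> the agents of \<open>D\<close> are supporters, the highest possible
  position, and none of them is indifferent, so the agreement clause only concerns agents outside
  \<open>D\<close>, where the profiles coincide.\<close>

lemma triples_le_chi_supporters:
  assumes "P \<in> profiles V A" "Q \<in> profiles V A"
    and "\<forall>v\<in>V - D. P v = Q v" "\<forall>v\<in>D. strictly_prefers (P v) a b"
  shows "(chi V a b Q, chi V a b P) \<in> triples_le V A"
  using assms
  by (intro triples_le_chiI)
    (auto simp: supporters_def indifferents_def strictly_prefers_def indifferent_def)

text \<open>The agents of \<open>D\<close> are neither supporters nor indifferent at
  \<open>P\<close>, so the order puts no constraint on them at \<open>Q\<close>.\<close>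

lemma triples_le_chi_opponents:
  assumes "P \<in> profiles V A" "Q \<in> profiles V A"
    and "\<forall>v\<in>V - D. P v = Q v" "\<forall>v\<in>D. strictly_prefers (P v) b a"
  shows "(chi V a b P, chi V a b Q) \<in> triples_le V A"
  using assms
  by (intro triples_le_chiI)
    (auto simp: supporters_def indifferents_def strictly_prefers_def indifferent_def)

lemma weakly_group_strategy_proof_phi:
  assumes "\<P> \<subseteq> profiles V A"
    and C: "super_order_closed (chi V a b ` \<P>) (Restr (triples_le V A) (chi V a b ` \<P>)) C"
  shows "weakly_group_strategy_proof V \<P> (phi \<P> a b (chi V a b) C)"
  unfolding weakly_group_strategy_proof_def
proof (intro notI, elim exE conjE)
  let ?\<phi> = "phi \<P> a b (chi V a b) C"
  fix D P Q
  assume D: "D \<noteq> {}" and PQ: "P \<in> \<P>" "Q \<in> \<P>" and eq: "\<forall>v\<in>V - D. P v = Q v"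
    and gain: "\<forall>v\<in>D. strictly_prefers (P v) (?\<phi> Q) (?\<phi> P)"
  have prof: "P \<in> profiles V A" "Q \<in> profiles V A" using PQ assms(1) by auto
  have up: "chi V a b Y \<in> C"
    if "X \<in> \<P>" "Y \<in> \<P>" "chi V a b X \<in> C" "(chi V a b X, chi V a b Y) \<in> triples_le V A" for X Y
    using that C unfolding super_order_closed_def by blast
  \<comment> \<open>Strict preference is irreflexive, and \<open>D\<close> has at least one
    member.\<close>
  have "?\<phi> Q \<noteq> ?\<phi> P"
    using D gain by (auto simp: strictly_prefers_def)
  then consider "chi V a b P \<notin> C" "chi V a b Q \<in> C" "?\<phi> P = b" "?\<phi> Q = a"
    | "chi V a b P \<in> C" "chi V a b Q \<notin> C" "?\<phi> P = a" "?\<phi> Q = b"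
    using PQ by (auto simp: phi_def split: if_splits)
  then show False
  proof cases
    case 1
    then show False
      using triples_le_chi_supporters[OF prof eq] gain up[OF PQ(2,1)] by simp
  next
    case 2
    then show False
      using triples_le_chi_opponents[OF prof eq] gain up[OF PQ] by simp
  qed
qed

text \<open>If \<open>P\<close> were assigned \<open>y\<close>, the coalition \<open>D\<close> would
  gain by moving to \<open>Q\<close>. Strategy-proofness says nothing about an empty
  \<open>D\<close>, but then \<open>P\<close> and \<open>Q\<close> agree on \<open>V\<close> and are
  equal by extensionality. The alternatives \<open>x\<close> and \<open>y\<close> are left generic
  so that the lemma serves with \<open>a\<close> and \<open>b\<close> in either role.\<close>

lemma weakly_group_strategy_proof_stable:
  assumes wgsp: "weakly_group_strategy_proof V \<P> \<phi>"
    and prof: "\<P> \<subseteq> profiles V A" and PQ: "P \<in> \<P>" "Q \<in> \<P>" and D: "D \<subseteq> V"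
    and eq: "\<forall>v\<in>V - D. P v = Q v" and pref: "\<forall>v\<in>D. strictly_prefers (P v) x y"
    and val: "\<phi> Q = x" "\<phi> P \<in> {x, y}"
  shows "\<phi> P = x"
proof (cases "D = {}")
  case True
  then have "P = Q"
    using PQ prof eq by (intro PiE_ext[of P V "\<lambda>_. preferences A"]) (auto simp: profiles_def)
  then show ?thesis using val by simp
next
  case False
  then have "\<not> (\<forall>v\<in>D. strictly_prefers (P v) (\<phi> Q) (\<phi> P))"
    using wgsp PQ D eq unfolding weakly_group_strategy_proof_def by blast
  then show ?thesis using val pref by auto
qed

lemma weakly_group_strategy_proof_mono:
  assumes AB: "a \<in> A" "b \<in> A" and qc: "quasi_cartesian V A \<P>"
    and wgsp: "weakly_group_strategy_proof V \<P> \<phi>" and \<phi>: "\<phi> \<in> \<P> \<rightarrow>\<^sub>E {a, b}"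
    and PQ: "P \<in> \<P>" "Q \<in> \<P>" and le: "(chi V a b P, chi V a b Q) \<in> triples_le V A"
    and a: "\<phi> P = a"
  shows "\<phi> Q = a"
proof (rule ccontr)
  assume "\<phi> Q \<noteq> a"
  then have b: "\<phi> Q = b" using \<phi> PQ by auto
  let ?S = "supporters V a b Q"
  define R where "R = override_on P Q ?S"
  have prof: "\<P> \<subseteq> profiles V A" using qc by (simp add: quasi_cartesian_def)
  have R: "R \<in> \<P>"
    using qc PQ by (simp add: quasi_cartesian_def R_def supporters_def)
  then have \<phi>R: "\<phi> R \<in> {a, b}" "\<phi> R \<in> {b, a}" using \<phi> by auto
  have "\<phi> R = a"
    by (rule weakly_group_strategy_proof_stable[OF wgsp prof R PQ(1), of ?S])
      (use a \<phi>R in \<open>auto simp: R_def supporters_def\<close>)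
  moreover have "\<phi> R = b"
  proof (rule weakly_group_strategy_proof_stable[OF wgsp prof R PQ(2)])
    \<comment> \<open>Taking all opponents at \<open>R\<close> leaves two kinds of agents: those in
      \<open>?S\<close>, where \<open>R\<close> is \<open>Q\<close> by construction, and those
      outside it who are indifferent at \<open>P\<close>.\<close>
    let ?D = "{v \<in> V. strictly_prefers (R v) b a}"
    show "\<forall>v\<in>V - ?D. R v = Q v"
    proof
      fix v assume v: "v \<in> V - ?D"
      show "R v = Q v"
      proof (cases "v \<in> ?S")
        case True
        then show ?thesis by (simp add: R_def)
      next
        case False
        then have RP: "R v = P v" by (simp add: R_def)
        have "P v \<in> preferences A" using v PQ prof by (auto simp: profiles_def)
        \<comment> \<open>A supporter at \<open>P\<close> would be a supporter at \<open>Q\<close>,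
          hence in \<open>?S\<close>.\<close>
        moreover have "\<not> strictly_prefers (P v) a b"
          using v False le by (auto simp: triples_le_def chi_def supporters_def)
        moreover have "\<not> strictly_prefers (P v) b a" using v RP by simp
        ultimately have "indifferent (P v) a b"
          using AB by (metis preferences_cases)
        then have "v \<in> indifferents V a b P" using v by (simp add: indifferents_def)
        \<comment> \<open>The second clause of the order leaves only indifference at
          \<open>Q\<close>; the third clause then gives \<open>P v = Q v\<close>.\<close>
        moreover from this have "v \<in> indifferents V a b Q"
          using False le by (auto simp: triples_le_def chi_def)
        ultimately show ?thesis using le RP by (auto simp: triples_le_def chi_def)
      qed
    qed
  qed (use b \<phi>R in auto)
  ultimately have "a = b" by simp
  with b \<open>\<phi> Q \<noteq> a\<close> show False by simp
qed

theorem theorem3p15: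
  fixes V :: "'v set" and A :: "'a set" and a b :: 'a and \<P> :: "('v \<Rightarrow> 'a rel) set"
  assumes "a \<in> A" and "b \<in> A" and "a \<noteq> b"
    and "quasi_cartesian V A \<P>"
  shows "bij_betw (phi \<P> a b (chi V a b))
    {C. super_order_closed (chi V a b ` \<P>) (Restr (triples_le V A) (chi V a b ` \<P>)) C}
    {\<phi> \<in> \<P> \<rightarrow>\<^sub>E {a, b}. weakly_group_strategy_proof V \<P> \<phi>}"
proof -
  let ?\<chi> = "chi V a b"
  let ?L = "?\<chi> ` \<P>"
  let ?soc = "super_order_closed ?L (Restr (triples_le V A) ?L)"
  have prof: "\<P> \<subseteq> profiles V A" using assms(4) by (simp add: quasi_cartesian_def)
  \<comment> \<open>This is a left inverse of the map, which yields injectivity; it also dictates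
    the witness \<open>?C\<close> for surjectivity.\<close>
  have recover: "?\<chi> ` {P \<in> \<P>. phi \<P> a b ?\<chi> C P = a} = C" if "?soc C" for C
  proof -
    have "C \<subseteq> ?L" using that by (simp add: super_order_closed_def)
    then show ?thesis using assms(3) by (auto simp: phi_def)
  qed
  have surj: "\<exists>C. ?soc C \<and> \<phi> = phi \<P> a b ?\<chi> C"
    if \<phi>: "\<phi> \<in> \<P> \<rightarrow>\<^sub>E {a, b}" "weakly_group_strategy_proof V \<P> \<phi>" for \<phi>
  proof (intro exI conjI)
    let ?C = "?\<chi> ` {P \<in> \<P>. \<phi> P = a}"
    have mono: "\<phi> Q = a" if "P \<in> \<P>" "Q \<in> \<P>" "(?\<chi> P, ?\<chi> Q) \<in> triples_le V A" "\<phi> P = a" for P Q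
      using weakly_group_strategy_proof_mono[OF assms(1,2,4) \<phi>(2,1)] that by blast
    show "?soc ?C" using mono by (auto simp: super_order_closed_def)
    \<comment> \<open>Distinct profiles may share a triple. Reflexivity of the order together with
      \<open>mono\<close> shows that \<phi> takes the value \<open>a\<close> at both or at
      neither.\<close>
    have in_C: "\<phi> P = a \<longleftrightarrow> ?\<chi> P \<in> ?C" if P: "P \<in> \<P>" for P
    proof
      assume "?\<chi> P \<in> ?C"
      then obtain P' where P': "P' \<in> \<P>" "\<phi> P' = a" "?\<chi> P = ?\<chi> P'" by blast
      have "(?\<chi> P', ?\<chi> P) \<in> triples_le V A"
        using partial_order_on_triples_le[of V A] chi_in_triples[of P V A a b] P prof P'(3)
        by (auto simp: partial_order_on_def preorder_on_def refl_on_def)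
      then show "\<phi> P = a" using mono P P' by blast
    qed (use P in blast)
    show "\<phi> = phi \<P> a b ?\<chi> ?C"
    proof (rule extensionalityI[of _ \<P>])
      fix P assume P: "P \<in> \<P>"
      then have "\<phi> P \<in> {a, b}" using \<phi>(1) by (rule PiE_mem[rotated])
      then show "\<phi> P = phi \<P> a b ?\<chi> ?C P"
        unfolding phi_def restrict_apply'[OF P] in_C[OF P, symmetric] by auto
    qed (use \<phi>(1) in \<open>simp_all add: phi_def PiE_def\<close>)
  qed
  show ?thesis
    unfolding bij_betw_def
  proof
    show "inj_on (phi \<P> a b ?\<chi>) {C. ?soc C}"
      using recover by (intro inj_on_inverseI[where g = "\<lambda>\<phi>. ?\<chi> ` {P \<in> \<P>. \<phi> P = a}"]) simp
    show "phi \<P> a b ?\<chi> ` {C. ?soc C} =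
        {\<phi> \<in> \<P> \<rightarrow>\<^sub>E {a, b}. weakly_group_strategy_proof V \<P> \<phi>}"
    proof (intro subset_antisym subsetI)
      fix \<phi> assume "\<phi> \<in> phi \<P> a b ?\<chi> ` {C. ?soc C}"
      then obtain C where C: "?soc C" and \<phi>: "\<phi> = phi \<P> a b ?\<chi> C" by blast
      have "\<phi> \<in> \<P> \<rightarrow>\<^sub>E {a, b}" by (simp add: \<phi> phi_def)
      with weakly_group_strategy_proof_phi[OF prof C]
      show "\<phi> \<in> {\<phi> \<in> \<P> \<rightarrow>\<^sub>E {a, b}. weakly_group_strategy_proof V \<P> \<phi>}"
        by (simp add: \<phi>)
    next
      fix \<phi> assume "\<phi> \<in> {\<phi> \<in> \<P> \<rightarrow>\<^sub>E {a, b}. weakly_group_strategy_proof V \<P> \<phi>}"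
      then obtain C where "?soc C" "\<phi> = phi \<P> a b ?\<chi> C" using surj by blast
      then show "\<phi> \<in> phi \<P> a b ?\<chi> ` {C. ?soc C}" by (intro image_eqI) simp_all
    qed
  qed
qed

end
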